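(* Let $ABC$ be a pure triangle in the Lorentzian plane. Let $P$ be any point such that the cevians through $P$ can be drawn from each vertex onto the opposite side, i.e. $P$ is distinct from $A,B,C$ and the lines $AP$, $BP$, $CP$ intersect the lines $BC$, $CA$, $AB$ in points $D$, $E$, $F$, respectively. If $D'$, $E'$, $F'$ are points on the lines $BC$, $CA$, $AB$, respectively, such that $AD$ and $AD'$ are isogonal, $BE$ and $BE'$ are isogonal, and $CF$ and $CF'$ are isogonal, then the lines $AD'$, $BE'$ and $CF'$ are concurrent.
   Context: The Lorentzian plane is $\mathbb{R}^2$ with the Lorentzian inner product $\vec u\circ\vec v=u_1v_1-u_2v_2$ for $\vec u=(u_1,u_2)$, $\vec v=(v_1,v_2)$. A non-zero vector $\vec u$ is called spacelike, lightlike or timelike according to whether $\vec u\circ\vec u$ is positive, zero or negative; this attribute is its causal character. A pure triangle is a (non-degenerate) triangle whose three side vectors all have the same causal character (so, in particular, none of the sides is lightlike). For a triangle $ABC$ put $\vec a=\overrightarrow{BC}$, $\vec b=\overrightarrow{CA}$, $\vec c=\overrightarrow{AB}$, so that $\vec a+\vec b+\vec c=0$. Given two non-lightlike non-zero vectors $\vec u,\vec v$, a vector $\vec w$ is an angle bisector of $\vec u$ and $\vec v$ if $$\frac{\vec u\circ\vec w}{\sqrt{|\vec u\circ\vec u|}}=\frac{\vec v\circ\vec w}{\sqrt{|\vec v\circ\vec v|}}.$$ The angle bisector line at $A$ (respectively $B$, $C$) is the line through that vertex directed by a non-zero angle bisector of $\vec b$ and $\vec c$ (respectively of $\vec c$ and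 $\vec a$, of $\vec a$ and $\vec b$); for a pure triangle it is never lightlike. The Lorentzian reflection across a non-lightlike line $\ell$ through a point $Q$ with direction $\vec w$ is the isometry fixing $\ell$ pointwise given by $Q+\vec x\mapsto Q-\vec x+2\frac{\vec x\circ\vec w}{\vec w\circ\vec w}\vec w$. A cevian is a line through a vertex and a point of the opposite side line. Two cevians through the same vertex are isogonal if they are reflections of each other across the angle bisector line at that vertex.
   Formalization: "Concurrent" is taken to mean that the three lines share a common point or are all parallel; the literal claim of a common point fails, for instance, for some P on the Lorentzian circle through A, B and C, where the isogonal lines are distinct and parallel. *)

theory Defs
  imports "HOL-Analysis.Analysis"
begin

definition lorentz :: "real^2 \<Rightarrow> real^2 \<Rightarrow> real" (infixl "\<circ>\<^sub>L" 70)
  where "u \<circ>\<^sub>L v = u $ 1 * v $ 1 - u $ 2 * v $ 2"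

datatype causal_character = Spacelike | Lightlike | Timelike

text \<open>The causal character is meaningful for non-zero vectors only; the value at \<open>0\<close> is a
  dummy, and \<open>pure_triangle\<close> below never uses it because its sides are non-zero.\<close>

definition causal :: "real^2 \<Rightarrow> causal_character"
  where "causal u =
    (if u \<circ>\<^sub>L u > 0 then Spacelike else if u \<circ>\<^sub>L u = 0 then Lightlike else Timelike)"

text \<open>That the sides are not lightlike is not required separately: a plane has only two lightlike
  directions, so three lightlike sides would make the triangle degenerate.\<close>

definition pure_triangle :: "real^2 \<Rightarrow> real^2 \<Rightarrow> real^2 \<Rightarrow> bool"
  where "pure_triangle A B C \<longleftrightarrow>
    \<not> collinear {A, B, C} \<and>
    causal (C - B) = causal (A - C) \<and> causal (A - C) = causal (B - A)"

definition angle_bisector :: "real^2 \<Rightarrow> real^2 \<Rightarrow> real^2 \<Rightarrow> bool"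
  where "angle_bisector u v w \<longleftrightarrow>
    (u \<circ>\<^sub>L w) / sqrt \<bar>u \<circ>\<^sub>L u\<bar> = (v \<circ>\<^sub>L w) / sqrt \<bar>v \<circ>\<^sub>L v\<bar>"

definition line_dir :: "real^2 \<Rightarrow> real^2 \<Rightarrow> (real^2) set"
  where "line_dir Q w = {Q + t *\<^sub>R w | t. True}"

text \<open>Reflection across \<open>line_dir Q w\<close>, for non-lightlike \<open>w\<close>; it depends only on that line.\<close>

definition lorentz_reflection :: "real^2 \<Rightarrow> real^2 \<Rightarrow> real^2 \<Rightarrow> real^2"
  where "lorentz_reflection Q w X =
    Q - (X - Q) + (2 * (((X - Q) \<circ>\<^sub>L w) / (w \<circ>\<^sub>L w))) *\<^sub>R w"

text \<open>In the next two definitions the first point is the vertex, and \<open>A, B, C\<close> may be replaced by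
  \<open>B, C, A\<close> or \<open>C, A, B\<close>.\<close>

definition cevian :: "real^2 \<Rightarrow> real^2 \<Rightarrow> real^2 \<Rightarrow> (real^2) set \<Rightarrow> bool"
  where "cevian A B C l \<longleftrightarrow> (\<exists>X \<in> affine hull {B, C}. l = affine hull {A, X})"

text \<open>The bisector at \<open>A\<close> is that of the cyclically oriented sides \<open>CA\<close> and \<open>AB\<close>. For a pure triangle
  its direction \<open>w\<close> is unique up to a factor and not lightlike.\<close>

definition isogonal :: "real^2 \<Rightarrow> real^2 \<Rightarrow> real^2 \<Rightarrow> (real^2) set \<Rightarrow> (real^2) set \<Rightarrow> bool"
  where "isogonal A B C l m \<longleftrightarrow>
    cevian A B C l \<and> cevian A B C m \<and>
    (\<exists>w. w \<noteq> 0 \<and> angle_bisector (A - C) (B - A) w \<and> lorentz_reflection A w ` l = m)"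

text \<open>Concurrency is meant in the projective sense: the lines share a point of the plane or a point
  at infinity, i.e. a direction. The second case does occur for isogonal cevians, namely when the
  original cevians meet on the Lorentzian circle through \<open>A\<close>, \<open>B\<close> and \<open>C\<close>.\<close>

definition concurrent :: "(real^2) set \<Rightarrow> (real^2) set \<Rightarrow> (real^2) set \<Rightarrow> bool"
  where "concurrent k l m \<longleftrightarrow>
    (\<exists>X. X \<in> k \<and> X \<in> l \<and> X \<in> m) \<or>
    (\<exists>w X Y Z. w \<noteq> 0 \<and> k = line_dir X w \<and> l = line_dir Y w \<and> m = line_dir Z w)"

end

theory Submission
  imports Defs
begin

text \<open>Write \<open>a\<close>, \<open>b\<close>, \<open>c\<close> for the side vectors. At \<open>A\<close> the bisector direction is
  \<open>b / |b| + c / |c|\<close>, so the reflection swaps the unit vectors of \<open>b\<close> and \<open>c\<close>. If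
  \<open>P = p A + q B + r C\<close>, the cevian along \<open>P - A = q c - r b\<close> is therefore reflected to the line
  through \<open>A\<close> directed by \<open>r (b \<circ> b) c - q (c \<circ> c) b\<close>. The equations of the three reflected lines,
  weighted by \<open>a \<circ> a\<close>, \<open>b \<circ> b\<close>, \<open>c \<circ> c\<close>, add up to zero, so the lines belong to a pencil.\<close>

section \<open>Determinants and barycentric coordinates in the plane\<close>

definition det2 :: "real^2 \<Rightarrow> real^2 \<Rightarrow> real"
  where "det2 u v = u $ 1 * v $ 2 - u $ 2 * v $ 1"

lemma det2_eq_0_imp_scaleR:
  assumes "det2 u v = 0" and "u \<noteq> 0"
  obtains k where "v = k *\<^sub>R u"
proof (cases "u $ 1 = 0")
  case True
  with assms have "u $ 2 \<noteq> 0" "v $ 1 = 0"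
    by (auto simp: det2_def vec_eq_iff forall_2)
  with True have "v = (v $ 2 / u $ 2) *\<^sub>R u"
    by (simp add: vec_eq_iff forall_2)
  then show ?thesis by (rule that)
next
  case False
  with assms have "v = (v $ 1 / u $ 1) *\<^sub>R u"
    by (simp add: vec_eq_iff forall_2 det2_def field_simps)
  then show ?thesis by (rule that)
qed

lemma det2_ne_0_if_not_collinear:
  assumes "\<not> collinear {A, B, C}"
  shows "det2 (A - C) (B - A) \<noteq> 0"
proof
  assume "det2 (A - C) (B - A) = 0"
  moreover have "A - C \<noteq> 0"
    using assms by (auto simp: insert_commute)
  ultimately obtain k where "B - A = k *\<^sub>R (A - C)"
    by (rule det2_eq_0_imp_scaleR)
  then have "B - A = (- k) *\<^sub>R (C - A)"
    by (simp add: algebra_simps)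
  then have "collinear {0, C - A, B - A}"
    unfolding collinear_lemma by blast
  then have "collinear {C, A, B}"
    by (subst collinear_3) (simp_all add: NO_MATCH_def)
  with assms show False
    by (simp add: insert_commute)
qed

lemma barycentric_coordinates:
  assumes "det2 (A - C) (B - A) \<noteq> 0"
  obtains p q r where "P = p *\<^sub>R A + q *\<^sub>R B + r *\<^sub>R C" and "p + q + r = 1"
proof
  let ?d = "det2 (A - C) (B - A)"
  \<comment> \<open>Cramer's rule for \<open>P - A\<close> in the basis \<open>B - A\<close>,
    \<open>C - A\<close>; since \<open>C - A\<close> is the negative of \<open>A - C\<close>, both
    numerators carry a plus sign.\<close>
  let ?q = "det2 (A - C) (P - A) / ?d" and ?r = "det2 (B - A) (P - A) / ?d"
  have "P - A = ?q *\<^sub>R (B - A) + ?r *\<^sub>R (C - A)"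
    using assms
    by (simp add: vec_eq_iff forall_2 field_simps) (simp add: det2_def algebra_simps)
  then show "P = (1 - ?q - ?r) *\<^sub>R A + ?q *\<^sub>R B + ?r *\<^sub>R C"
    by (simp add: algebra_simps)
qed simp

section \<open>The Lorentzian product and its reflections\<close>

lemma lorentz_commute: "u \<circ>\<^sub>L v = v \<circ>\<^sub>L u"
  and lorentz_add_left: "(u + v) \<circ>\<^sub>L w = u \<circ>\<^sub>L w + v \<circ>\<^sub>L w"
  and lorentz_add_right: "w \<circ>\<^sub>L (u + v) = w \<circ>\<^sub>L u + w \<circ>\<^sub>L v"
  and lorentz_diff_left: "(u - v) \<circ>\<^sub>L w = u \<circ>\<^sub>L w - v \<circ>\<^sub>L w"
  and lorentz_scaleR_left: "(k *\<^sub>R u) \<circ>\<^sub>L w = k * (u \<circ>\<^sub>L w)"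
  and lorentz_scaleR_right: "w \<circ>\<^sub>L (k *\<^sub>R u) = k * (w \<circ>\<^sub>L u)"
  by (simp_all add: lorentz_def algebra_simps)

text \<open>The Lorentzian counterpart of Lagrange's identity: the signature makes the Gram
  determinant minus a square. When it vanishes, the vectors are dependent.\<close>

lemma lorentz_gram: "(u \<circ>\<^sub>L v)\<^sup>2 - (u \<circ>\<^sub>L u) * (v \<circ>\<^sub>L v) = (det2 u v)\<^sup>2"
  by (simp add: lorentz_def det2_def power2_eq_square algebra_simps)

text \<open>The form is nondegenerate, so the orthogonal complement of a non-zero vector is
  one-dimensional, even when that vector is lightlike.\<close>

lemma orthogonal_to_same_imp_scaleR:
  assumes "v \<circ>\<^sub>L s = 0" and "v \<circ>\<^sub>L w = 0" and "v \<noteq> 0" and "s \<noteq> 0"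
  obtains k where "w = k *\<^sub>R s"
proof (rule det2_eq_0_imp_scaleR)
  have "v $ 1 * det2 s w = 0" "v $ 2 * det2 s w = 0"
    using assms(1,2) unfolding lorentz_def det2_def by algebra+
  with \<open>v \<noteq> 0\<close> show "det2 s w = 0"
    by (auto simp: vec_eq_iff forall_2)
qed (use assms in auto)

text \<open>The linear part of \<open>lorentz_reflection\<close>, which acts on directions.\<close>

definition refl_vec :: "real^2 \<Rightarrow> real^2 \<Rightarrow> real^2"
  where "refl_vec w x = (2 * ((x \<circ>\<^sub>L w) / (w \<circ>\<^sub>L w))) *\<^sub>R w - x"

lemma refl_vec_scaleR: "refl_vec w (k *\<^sub>R x) = k *\<^sub>R refl_vec w x"
  by (simp add: refl_vec_def lorentz_scaleR_left algebra_simps)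

lemma refl_vec_diff: "refl_vec w (x - y) = refl_vec w x - refl_vec w y"
  by (simp add: refl_vec_def lorentz_diff_left diff_divide_distrib algebra_simps)

lemma refl_vec_scaleR_axis: "k \<noteq> 0 \<Longrightarrow> refl_vec (k *\<^sub>R w) x = refl_vec w x"
  by (simp add: refl_vec_def lorentz_scaleR_left lorentz_scaleR_right)

lemma lorentz_reflection_image_line_dir:
  "lorentz_reflection Q w ` line_dir Q x = line_dir Q (refl_vec w x)"
proof -
  have "lorentz_reflection Q w (Q + t *\<^sub>R x) = Q + t *\<^sub>R refl_vec w x" for t
    by (simp add: lorentz_reflection_def refl_vec_def lorentz_scaleR_left algebra_simps)
  then show ?thesis
    unfolding line_dir_def by (auto simp: image_iff) metis
qed

section \<open>Lines as affine hulls and by direction\<close>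

lemma line_dir_scaleR:
  assumes "k \<noteq> 0"
  shows "line_dir Q (k *\<^sub>R w) = line_dir Q w"
proof -
  have "Q + t *\<^sub>R w = Q + (t / k) *\<^sub>R k *\<^sub>R w" for t
    using assms by simp
  then show ?thesis
    unfolding line_dir_def by fastforce
qed

lemma affine_hull_2_line_dir: "affine hull {A, P} = line_dir A (P - A)"
  by (auto simp: affine_hull_2_alt line_dir_def)

text \<open>Allows the foot of a cevian to be replaced by \<open>P\<close>.\<close>

lemma affine_hull_2_eq:
  fixes A D P :: "real^2"
  assumes "D \<in> affine hull {A, P}" and "D \<noteq> A"
  shows "affine hull {A, D} = affine hull {A, P}"
proof -
  obtain t where "D = A + t *\<^sub>R (P - A)"
    using assms(1) by (auto simp: affine_hull_2_alt)
  then have D: "D - A = t *\<^sub>R (P - A)"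
    by simp
  then have "t \<noteq> 0"
    using assms(2) by auto
  then show ?thesis
    unfolding affine_hull_2_line_dir D by (rule line_dir_scaleR)
qed

text \<open>Keeps the foot of a cevian away from its vertex, so that vertex and foot determine a
  line.\<close>

lemma vertex_notin_opposite_side:
  assumes "\<not> collinear {A, B, C}"
  shows "A \<notin> affine hull {B, C}"
proof
  assume "A \<in> affine hull {B, C}"
  then have "affine hull {A, B, C} = affine hull {B, C}"
    by (rule hull_redundant)
  then have "collinear {A, B, C}"
    by (metis collinear_2 collinear_affine_hull_collinear)
  with assms show False ..
qed

section \<open>Angle bisectors and isogonal lines\<close>

lemma refl_vec_bisector:
  assumes bis: "angle_bisector b c w" and "w \<noteq> 0"
    and indep: "det2 b c \<noteq> 0" and same: "(b \<circ>\<^sub>L b) * (c \<circ>\<^sub>L c) > 0"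
  defines "\<beta> \<equiv> sqrt \<bar>b \<circ>\<^sub>L b\<bar>" and "\<gamma> \<equiv> sqrt \<bar>c \<circ>\<^sub>L c\<bar>"
  shows "refl_vec w b = (\<beta> / \<gamma>) *\<^sub>R c" and "refl_vec w c = (\<gamma> / \<beta>) *\<^sub>R b"
proof -
  define u v where "u = b /\<^sub>R \<beta>" and "v = c /\<^sub>R \<gamma>"
  define s where "s = u + v"
  have pos: "\<beta> > 0" "\<gamma> > 0"
    using same by (auto simp: \<beta>_def \<gamma>_def)
  have b: "b = \<beta> *\<^sub>R u" and c: "c = \<gamma> *\<^sub>R v"
    using pos by (simp_all add: u_def v_def)
  have sq: "\<beta>\<^sup>2 = \<bar>b \<circ>\<^sub>L b\<bar>" "\<gamma>\<^sup>2 = \<bar>c \<circ>\<^sub>L c\<bar>"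
    by (simp_all add: \<beta>_def \<gamma>_def)
  have "u \<circ>\<^sub>L u = (b \<circ>\<^sub>L b) / \<beta>\<^sup>2" "v \<circ>\<^sub>L v = (c \<circ>\<^sub>L c) / \<gamma>\<^sup>2"
    by (simp_all add: u_def v_def lorentz_scaleR_left lorentz_scaleR_right power2_eq_square
        field_simps)
  \<comment> \<open>Both sides are 1 or both are -1, because \<open>b\<close> and \<open>c\<close>
    have the same causal character.\<close>
  then have uv: "u \<circ>\<^sub>L u = v \<circ>\<^sub>L v"
    using same unfolding sq by (auto simp: zero_less_mult_iff)
  have "det2 b c = \<beta> * \<gamma> * det2 u v"
    unfolding b c by (simp add: det2_def algebra_simps)
  with indep have d: "det2 u v \<noteq> 0"
    by auto
  then have "u \<noteq> v"
    by (auto simp: det2_def)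
  have ss: "s \<circ>\<^sub>L s = 2 * (u \<circ>\<^sub>L s)" "s \<circ>\<^sub>L s = 2 * (v \<circ>\<^sub>L s)"
    by (simp_all add: s_def lorentz_add_left lorentz_add_right uv lorentz_commute[of v u])
  \<comment> \<open>If \<open>s\<close> were lightlike, the Gram determinant of \<open>u\<close> and
    \<open>v\<close> would vanish, against their independence.\<close>
  have "s \<circ>\<^sub>L s \<noteq> 0"
  proof
    assume "s \<circ>\<^sub>L s = 0"
    then have "u \<circ>\<^sub>L v = - (v \<circ>\<^sub>L v)"
      using ss by (simp add: s_def lorentz_add_right uv)
    then have "(det2 u v)\<^sup>2 = 0"
      unfolding lorentz_gram[symmetric] uv by (simp add: power2_eq_square)
    with d show False by simp
  qed
  \<comment> \<open>Both \<open>s\<close> and \<open>w\<close> are orthogonal to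
    \<open>u - v\<close>: \<open>s\<close> because \<open>u\<close> and \<open>v\<close> have equal
    squares, \<open>w\<close> by the bisector equation. Hence they are parallel.\<close>
  have "(u - v) \<circ>\<^sub>L s = 0"
    using ss by (simp add: lorentz_diff_left)
  moreover have "(u - v) \<circ>\<^sub>L w = 0"
    using bis by (simp add: angle_bisector_def u_def v_def lorentz_diff_left lorentz_scaleR_left
        \<beta>_def \<gamma>_def field_simps)
  moreover have "s \<noteq> 0"
    using \<open>s \<circ>\<^sub>L s \<noteq> 0\<close> by (auto simp: lorentz_def)
  ultimately obtain k where k: "w = k *\<^sub>R s"
    using \<open>u \<noteq> v\<close> orthogonal_to_same_imp_scaleR[of "u - v" s w] by auto
  with \<open>w \<noteq> 0\<close> have "k \<noteq> 0" by auto
  then have w: "refl_vec w = refl_vec s"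
    unfolding k by (intro ext refl_vec_scaleR_axis)
  \<comment> \<open>The projections of \<open>u\<close> and \<open>v\<close> to \<open>s\<close> are
    both \<open>s / 2\<close>, so reflecting sends each to \<open>s\<close> minus itself, which is
    the other.\<close>
  have half: "2 * ((u \<circ>\<^sub>L s) / (s \<circ>\<^sub>L s)) = 1" "2 * ((v \<circ>\<^sub>L s) / (s \<circ>\<^sub>L s)) = 1"
    using ss \<open>s \<circ>\<^sub>L s \<noteq> 0\<close> by simp_all
  have swap: "refl_vec s u = v" "refl_vec s v = u"
    unfolding refl_vec_def half by (simp_all add: s_def)
  have "refl_vec w b = \<beta> *\<^sub>R v" "refl_vec w c = \<gamma> *\<^sub>R u"
    by (simp_all only: w b c refl_vec_scaleR swap)
  then show "refl_vec w b = (\<beta> / \<gamma>) *\<^sub>R c" "refl_vec w c = (\<gamma> / \<beta>) *\<^sub>R b"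
    by (simp_all add: u_def v_def divide_inverse)
qed

text \<open>Clearing the square roots from the reflected direction gives \<open>d\<close>, whose
  coefficients are polynomial in the data, as the final cancellation requires.\<close>

lemma isogonal_line_direction:
  assumes iso: "isogonal A B C (affine hull {A, P}) m" and "P \<noteq> A"
    and P: "P = p *\<^sub>R A + q *\<^sub>R B + r *\<^sub>R C" "p + q + r = 1"
    and indep: "det2 (A - C) (B - A) \<noteq> 0"
    and same: "((A - C) \<circ>\<^sub>L (A - C)) * ((B - A) \<circ>\<^sub>L (B - A)) > 0"
  defines "d \<equiv> (r * ((A - C) \<circ>\<^sub>L (A - C))) *\<^sub>R (B - A) - (q * ((B - A) \<circ>\<^sub>L (B - A))) *\<^sub>R (A - C)"
  shows "m = line_dir A d" and "d \<noteq> 0"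
proof -
  define b c where "b = A - C" and "c = B - A"
  define \<beta> \<gamma> where "\<beta> = sqrt \<bar>b \<circ>\<^sub>L b\<bar>" and "\<gamma> = sqrt \<bar>c \<circ>\<^sub>L c\<bar>"
  note same = same[folded b_def c_def] and indep = indep[folded b_def c_def]
  have d: "d = (r * (b \<circ>\<^sub>L b)) *\<^sub>R c - (q * (c \<circ>\<^sub>L c)) *\<^sub>R b"
    by (simp add: d_def b_def c_def)
  have pos: "\<beta> > 0" "\<gamma> > 0"
    using same by (auto simp: \<beta>_def \<gamma>_def)
  have p: "p = 1 - q - r"
    using P(2) by simp
  have PA: "P - A = q *\<^sub>R c - r *\<^sub>R b"
    unfolding P(1) b_def c_def p by (simp add: algebra_simps)
  obtain w where w: "w \<noteq> 0" "angle_bisector b c w"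
    and m: "lorentz_reflection A w ` (affine hull {A, P}) = m"
    using iso unfolding isogonal_def b_def c_def by blast
  note R = refl_vec_bisector[OF w(2,1) indep same, folded \<beta>_def \<gamma>_def]
  \<comment> \<open>The common sign of the two squares, which recovers them from their absolute
    values.\<close>
  define \<epsilon> where "\<epsilon> = sgn (b \<circ>\<^sub>L b)"
  have "\<epsilon> \<noteq> 0" and \<epsilon>: "\<epsilon> * (\<epsilon> * x) = x" for x
    using same by (auto simp: \<epsilon>_def sgn_if)
  have sq: "b \<circ>\<^sub>L b = \<epsilon> * \<beta>\<^sup>2" "c \<circ>\<^sub>L c = \<epsilon> * \<gamma>\<^sup>2"
    using same by (auto simp: \<epsilon>_def \<beta>_def \<gamma>_def sgn_if abs_if zero_less_mult_iff)
  have "refl_vec w (P - A) = (q * (\<gamma> / \<beta>)) *\<^sub>R b - (r * (\<beta> / \<gamma>)) *\<^sub>R c"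
    by (simp add: PA refl_vec_diff refl_vec_scaleR R)
  also have "\<dots> = (- \<epsilon> / (\<beta> * \<gamma>)) *\<^sub>R d"
    unfolding d sq using pos
    by (simp add: \<epsilon> scaleR_diff_right power2_eq_square field_simps)
  finally have "refl_vec w (P - A) = (- \<epsilon> / (\<beta> * \<gamma>)) *\<^sub>R d" .
  then show "m = line_dir A d"
    using m pos \<open>\<epsilon> \<noteq> 0\<close>
    by (simp add: affine_hull_2_line_dir lorentz_reflection_image_line_dir line_dir_scaleR
        del: scaleR_minus_left)
  show "d \<noteq> 0"
  proof
    assume "d = 0"
    \<comment> \<open>Pairing \<open>d\<close> with \<open>b\<close> and with \<open>c\<close>
      isolates the coefficients; if both vanish, then \<open>P = A\<close>.\<close>
    have "det2 b d = r * (b \<circ>\<^sub>L b) * det2 b c" "det2 c d = q * (c \<circ>\<^sub>L c) * det2 b c"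
      by (simp_all add: d det2_def algebra_simps)
    then have "r = 0" "q = 0"
      using \<open>d = 0\<close> same indep by (auto simp: det2_def)
    with PA \<open>P \<noteq> A\<close> show False by simp
  qed
qed

section \<open>Signs of the sides, and lines in a pencil\<close>

lemma pure_triangle_signs:
  assumes "pure_triangle A B C"
  shows "((C - B) \<circ>\<^sub>L (C - B)) * ((A - C) \<circ>\<^sub>L (A - C)) > 0"
    and "((A - C) \<circ>\<^sub>L (A - C)) * ((B - A) \<circ>\<^sub>L (B - A)) > 0"
    and "((B - A) \<circ>\<^sub>L (B - A)) * ((C - B) \<circ>\<^sub>L (C - B)) > 0"
proof -
  let ?a = "C - B" and ?b = "A - C" and ?c = "B - A"
  \<comment> \<open>Equal causal characters still admit three lightlike sides. As \<open>?a\<close>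
    is minus the sum of \<open>?b\<close> and \<open>?c\<close>, these two would then be orthogonal
    with zero Gram determinant, and the triangle degenerate.\<close>
  have "\<not> (?a \<circ>\<^sub>L ?a = 0 \<and> ?b \<circ>\<^sub>L ?b = 0 \<and> ?c \<circ>\<^sub>L ?c = 0)"
  proof
    assume light: "?a \<circ>\<^sub>L ?a = 0 \<and> ?b \<circ>\<^sub>L ?b = 0 \<and> ?c \<circ>\<^sub>L ?c = 0"
    have "?a \<circ>\<^sub>L ?a = ?b \<circ>\<^sub>L ?b + 2 * (?b \<circ>\<^sub>L ?c) + ?c \<circ>\<^sub>L ?c"
      by (simp add: lorentz_def algebra_simps)
    with light have "?b \<circ>\<^sub>L ?c = 0" by simp
    with light have "det2 ?b ?c = 0"
      using lorentz_gram[of ?b ?c] by simp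
    with assms show False
      using det2_ne_0_if_not_collinear by (auto simp: pure_triangle_def)
  qed
  with assms show "(?a \<circ>\<^sub>L ?a) * (?b \<circ>\<^sub>L ?b) > 0" "(?b \<circ>\<^sub>L ?b) * (?c \<circ>\<^sub>L ?c) > 0"
    "(?c \<circ>\<^sub>L ?c) * (?a \<circ>\<^sub>L ?a) > 0"
    by (auto simp: pure_triangle_def causal_def zero_less_mult_iff split: if_splits)
qed

text \<open>Each determinant is the equation in \<open>X\<close> of one line. A common point of the
  first two lines solves the third equation because \<open>m\<close> is non-zero; if the first two
  are parallel, the third shares their direction.\<close>

lemma concurrent_if_equations_dependent:
  assumes dep: "\<And>X. k * det2 (X - A) u + l * det2 (X - B) v + m * det2 (X - C) w = 0"
    and nz: "m \<noteq> 0" "u \<noteq> 0" "v \<noteq> 0" "w \<noteq> 0"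
  shows "concurrent (line_dir A u) (line_dir B v) (line_dir C w)"
proof (cases "det2 u v = 0")
  case False
  \<comment> \<open>The factor of \<open>u\<close> solves \<open>det2 (X - B) v = 0\<close> along
    the line through \<open>A\<close>.\<close>
  define X where "X = A + (det2 (B - A) v / det2 u v) *\<^sub>R u"
  have XA: "X - A = (det2 (B - A) v / det2 u v) *\<^sub>R u"
    by (simp add: X_def)
  have on_line: "X \<in> line_dir Q d" if det: "det2 (X - Q) d = 0" and "d \<noteq> 0" for Q d
  proof -
    have "det2 d (X - Q) = 0"
      using det by (simp add: det2_def algebra_simps)
    then obtain t where "X - Q = t *\<^sub>R d"
      using \<open>d \<noteq> 0\<close> by (rule det2_eq_0_imp_scaleR)
    then have "X = Q + t *\<^sub>R d"
      by (simp add: algebra_simps)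
    then show ?thesis
      by (auto simp: line_dir_def)
  qed
  have 1: "det2 (X - A) u = 0"
    by (simp add: XA det2_def)
  have "det2 (X - B) v = det2 (X - A) v - det2 (B - A) v"
    by (simp add: det2_def algebra_simps)
  also have "det2 (X - A) v = det2 (B - A) v / det2 u v * det2 u v"
    unfolding XA by (simp add: det2_def[of "_ *\<^sub>R _"] det2_def[of u] right_diff_distrib)
  finally have 2: "det2 (X - B) v = 0"
    using False by simp
  have 3: "det2 (X - C) w = 0"
    using dep[of X] nz(1) by (simp add: 1 2)
  show ?thesis
    unfolding concurrent_def using on_line 1 2 3 nz by blast
next
  case True
  \<comment> \<open>Subtracting the identity at \<open>A\<close> from that at \<open>A + u\<close>
    leaves its linear part, evaluated at \<open>u\<close>.\<close>
  have "k * det2 u u + l * det2 u v + m * det2 u w = 0"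
    using dep[of "A + u"] dep[of A] by (simp add: det2_def algebra_simps)
  with True nz(1) have "det2 u w = 0"
    by (simp add: det2_def)
  then obtain s where s: "w = s *\<^sub>R u"
    using nz(2) by (rule det2_eq_0_imp_scaleR)
  obtain t where t: "v = t *\<^sub>R u"
    using True nz(2) by (rule det2_eq_0_imp_scaleR)
  have "s \<noteq> 0" "t \<noteq> 0"
    using s t nz by auto
  then have "line_dir B v = line_dir B u" "line_dir C w = line_dir C u"
    by (simp_all add: s t line_dir_scaleR)
  then show ?thesis
    unfolding concurrent_def using nz(2) by blast
qed

theorem theorem6:
  fixes A B C P D E F D' E' F' :: "real^2"
  assumes "pure_triangle A B C"
    and "P \<noteq> A" and "P \<noteq> B" and "P \<noteq> C"
    and "D \<in> affine hull {A, P} \<inter> affine hull {B, C}"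
    and "E \<in> affine hull {B, P} \<inter> affine hull {C, A}"
    and "F \<in> affine hull {C, P} \<inter> affine hull {A, B}"
    and "D' \<in> affine hull {B, C}"
    and "E' \<in> affine hull {C, A}"
    and "F' \<in> affine hull {A, B}"
    and "isogonal A B C (affine hull {A, D}) (affine hull {A, D'})"
    and "isogonal B C A (affine hull {B, E}) (affine hull {B, E'})"
    and "isogonal C A B (affine hull {C, F}) (affine hull {C, F'})"
  shows "concurrent (affine hull {A, D'}) (affine hull {B, E'}) (affine hull {C, F'})"
proof -
  let ?a = "C - B" and ?b = "A - C" and ?c = "B - A"
  have nc: "\<not> collinear {A, B, C}" "\<not> collinear {B, C, A}" "\<not> collinear {C, A, B}"
    using assms(1) by (simp_all add: pure_triangle_def insert_commute)
  have "D \<noteq> A" "E \<noteq> B" "F \<noteq> C"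
    using assms(5-7) nc[THEN vertex_notin_opposite_side] by auto
  then have hulls: "affine hull {A, D} = affine hull {A, P}"
    "affine hull {B, E} = affine hull {B, P}" "affine hull {C, F} = affine hull {C, P}"
    using assms(5-7) by (auto intro!: affine_hull_2_eq)
  note indep = nc[THEN det2_ne_0_if_not_collinear]
  note signs = pure_triangle_signs[OF assms(1)]
  obtain p q r where P: "P = p *\<^sub>R A + q *\<^sub>R B + r *\<^sub>R C" "p + q + r = 1"
    using indep(1) by (rule barycentric_coordinates)
  \<comment> \<open>Rotating the coordinates with the vertices makes the result at \<open>A\<close>
    apply at \<open>B\<close> and \<open>C\<close>.\<close>
  then have P': "P = q *\<^sub>R B + r *\<^sub>R C + p *\<^sub>R A" "q + r + p = 1"
    "P = r *\<^sub>R C + p *\<^sub>R A + q *\<^sub>R B" "r + p + q = 1"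
    by (simp_all add: algebra_simps)
  note lineA = isogonal_line_direction
    [OF assms(11)[unfolded hulls] assms(2) P indep(1) signs(2)]
  note lineB = isogonal_line_direction
    [OF assms(12)[unfolded hulls] assms(3) P'(1,2) indep(2) signs(3)]
  note lineC = isogonal_line_direction
    [OF assms(13)[unfolded hulls] assms(4) P'(3,4) indep(3) signs(1)]
  show ?thesis
    unfolding lineA(1) lineB(1) lineC(1)
  proof (rule concurrent_if_equations_dependent)
    fix X
    \<comment> \<open>The identity holds with arbitrary numbers in place of the three squares, so
      they are made opaque. The terms cancel in pairs: those with \<open>r\<close>, for instance,
      leave a multiple of \<open>det2 ?c ?c\<close>, as \<open>X\<close> drops out.\<close>
    define \<alpha> \<beta> \<gamma> where "\<alpha> = ?a \<circ>\<^sub>L ?a" and "\<beta> = ?b \<circ>\<^sub>L ?b" and "\<gamma> = ?c \<circ>\<^sub>L ?c"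
    show "(?a \<circ>\<^sub>L ?a) * det2 (X - A) ((r * (?b \<circ>\<^sub>L ?b)) *\<^sub>R ?c - (q * (?c \<circ>\<^sub>L ?c)) *\<^sub>R ?b) +
        (?b \<circ>\<^sub>L ?b) * det2 (X - B) ((p * (?c \<circ>\<^sub>L ?c)) *\<^sub>R ?a - (r * (?a \<circ>\<^sub>L ?a)) *\<^sub>R ?c) +
        (?c \<circ>\<^sub>L ?c) * det2 (X - C) ((q * (?a \<circ>\<^sub>L ?a)) *\<^sub>R ?b - (p * (?b \<circ>\<^sub>L ?b)) *\<^sub>R ?a) = 0"
      unfolding \<alpha>_def[symmetric] \<beta>_def[symmetric] \<gamma>_def[symmetric]
      by (simp add: det2_def algebra_simps)
  qed (use lineA(2) lineB(2) lineC(2) signs in auto)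
qed

end
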